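(* Let $S$ be a finite simple group and $G$ a finite group such that $\mathrm{cod}(S)\subseteq\mathrm{cod}(G)$. Then $|S|$ divides $|G|$.
   Context: For a finite group $G$, $\mathrm{Irr}(G)$ is the set of complex irreducible characters of $G$. The codegree of $\chi\in\mathrm{Irr}(G)$ is $\mathrm{cod}(\chi)=|G:\ker(\chi)|/\chi(1)$, and $\mathrm{cod}(G)=\{\mathrm{cod}(\chi):\chi\in\mathrm{Irr}(G)\}$. *)

theory Defs
  imports
    "HOL-Algebra.SimpleGroups"
    "Jordan_Normal_Form.VS_Connect"
begin

definition GL :: "nat \<Rightarrow> complex mat monoid" where
  "GL n = units_of (ring_mat TYPE(complex) n ())"

definition representation :: "('a, 'm) monoid_scheme \<Rightarrow> nat \<Rightarrow> ('a \<Rightarrow> complex mat) \<Rightarrow> bool" where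
  "representation G n \<rho> \<longleftrightarrow> \<rho> \<in> hom G (GL n)"

definition invariant_subspace ::
    "('a, 'm) monoid_scheme \<Rightarrow> nat \<Rightarrow> ('a \<Rightarrow> complex mat) \<Rightarrow> complex vec set \<Rightarrow> bool" where
  "invariant_subspace G n \<rho> W \<longleftrightarrow>
     VectorSpace.subspace class_ring W (module_vec TYPE(complex) n) \<and>
     (\<forall>g\<in>carrier G. \<forall>w\<in>W. \<rho> g *\<^sub>v w \<in> W)"

definition irreducible_representation ::
    "('a, 'm) monoid_scheme \<Rightarrow> nat \<Rightarrow> ('a \<Rightarrow> complex mat) \<Rightarrow> bool" where
  "irreducible_representation G n \<rho> \<longleftrightarrow>
     representation G n \<rho> \<and> n > 0 \<and>
     (\<forall>W. invariant_subspace G n \<rho> W \<longrightarrow> W = {0\<^sub>v n} \<or> W = carrier_vec n)"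

definition mat_trace :: "complex mat \<Rightarrow> complex" where
  "mat_trace A = (\<Sum>i<dim_row A. A $$ (i, i))"

(* Restricting to the carrier makes characters equal as soon as they agree on the group. *)
definition character_of :: "('a, 'm) monoid_scheme \<Rightarrow> ('a \<Rightarrow> complex mat) \<Rightarrow> 'a \<Rightarrow> complex" where
  "character_of G \<rho> = (\<lambda>g\<in>carrier G. mat_trace (\<rho> g))"

definition Irr :: "('a, 'm) monoid_scheme \<Rightarrow> ('a \<Rightarrow> complex) set" where
  "Irr G = {character_of G \<rho> | n \<rho>. irreducible_representation G n \<rho>}"

(* For a character of a finite group this is the kernel of any representation affording it. *)
definition char_kernel :: "('a, 'm) monoid_scheme \<Rightarrow> ('a \<Rightarrow> complex) \<Rightarrow> 'a set" where
  "char_kernel G \<chi> = {g \<in> carrier G. \<chi> g = \<chi> \<one>\<^bsub>G\<^esub>}"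

(* The value is a positive integer for an irreducible character; it is kept in the complex
   numbers, where the character takes its values, so that the division is exact. *)
definition codegree :: "('a, 'm) monoid_scheme \<Rightarrow> ('a \<Rightarrow> complex) \<Rightarrow> complex" where
  "codegree G \<chi> = of_nat (card (rcosets\<^bsub>G\<^esub> (char_kernel G \<chi>))) / \<chi> \<one>\<^bsub>G\<^esub>"

definition cod :: "('a, 'm) monoid_scheme \<Rightarrow> complex set" where
  "cod G = codegree G ` Irr G"

end

theory Submission
imports
  Defs
  "Jordan_Normal_Form.Schur_Decomposition"
  "HOL-Algebra.Multiplicative_Group"
begin

text \<open>A nontrivial irreducible character \<open>\<chi>\<close> of degree \<open>n\<close> of \<open>S\<close> has trivial kernel, so its codegree
  is \<open>|S| / n\<close>. If this equals \<open>|G : K| / k\<close> for an irreducible character of \<open>G\<close> of degree \<open>k\<close> with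
  kernel \<open>K\<close>, then \<open>|S| k |K| = n |G|\<close>, so \<open>|S|\<close> divides \<open>n |G|\<close>. The regular character of \<open>S\<close> is a sum
  of irreducible characters in which the trivial one occurs exactly once; hence \<open>|S| - 1\<close> is a sum of
  nontrivial irreducible degrees and \<open>|S|\<close> divides \<open>(|S| - 1) |G|\<close>, that is, \<open>|S|\<close> divides \<open>|G|\<close>.
  Splitting into irreducible characters only needs block triangular form along an invariant
  subspace, neither Maschke's theorem nor orthogonality.\<close>

section \<open>Traces and matrices of finite order\<close>

lemma mat_trace_comm:
  assumes "A \<in> carrier_mat n m" and "B \<in> carrier_mat m n"
  shows "mat_trace (A * B) = mat_trace (B * A)"
proof -
  have "mat_trace (A * B) = (\<Sum>i<n. \<Sum>j<m. A $$ (i, j) * B $$ (j, i))"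
    using assms by (simp add: mat_trace_def scalar_prod_def atLeast0LessThan)
  also have "\<dots> = (\<Sum>j<m. \<Sum>i<n. B $$ (j, i) * A $$ (i, j))"
    by (subst sum.swap) (simp add: mult.commute)
  also have "\<dots> = mat_trace (B * A)"
    using assms by (simp add: mat_trace_def scalar_prod_def atLeast0LessThan)
  finally show ?thesis .
qed

lemma mat_trace_conj:
  assumes "A \<in> carrier_mat n n" "P \<in> carrier_mat n n" "Q \<in> carrier_mat n n" "P * Q = 1\<^sub>m n"
  shows "mat_trace (Q * A * P) = mat_trace A"
proof -
  have "mat_trace (Q * A * P) = mat_trace (P * (Q * A))"
    by (rule mat_trace_comm) (use assms in auto)
  also have "P * (Q * A) = P * Q * A"
    by (rule assoc_mult_mat[symmetric]) (use assms in auto)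
  finally show ?thesis using assms by simp
qed

lemma mat_trace_one [simp]: "mat_trace (1\<^sub>m n) = of_nat n"
  by (simp add: mat_trace_def)

section \<open>Triangular matrices and their powers\<close>

text \<open>A nonzero term \<open>A $$ (i, l) * B $$ (l, j)\<close> requires i \<le> l \<le> j. For
  j < i no index qualifies, and for j = i only l = i does.\<close>

lemma upper_triangular_mult:
  assumes "A \<in> carrier_mat n n" "B \<in> carrier_mat n n"
    and "upper_triangular A" "upper_triangular (B :: 'a :: comm_ring_1 mat)"
  shows "upper_triangular (A * B)"
    and "\<And>i. i < n \<Longrightarrow> (A * B) $$ (i, i) = A $$ (i, i) * B $$ (i, i)"
proof -
  have zero: "A $$ (i, l) * B $$ (l, j) = 0"
    if "i < n" "l < n" "j \<le> i" "j < i \<or> l \<noteq> i" for i j l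
  proof (cases "l < i")
    case True then show ?thesis using assms that upper_triangularD[of A l i] by simp
  next
    case False
    then have "j < l" using that by auto
    then show ?thesis using assms that upper_triangularD[of B j l] by simp
  qed
  have entry: "(A * B) $$ (i, j) = (\<Sum>l<n. A $$ (i, l) * B $$ (l, j))" if "i < n" "j < n" for i j
    using assms that by (simp add: scalar_prod_def atLeast0LessThan)
  show "upper_triangular (A * B)"
  proof (intro upper_triangularI)
    fix i j assume "j < i" "i < dim_row (A * B)"
    then show "(A * B) $$ (i, j) = 0"
      using assms by (subst entry) (auto intro!: sum.neutral zero)
  qed
  show "(A * B) $$ (i, i) = A $$ (i, i) * B $$ (i, i)" if "i < n" for i
  proof -
    have "(A * B) $$ (i, i) = (\<Sum>l<n. if l = i then A $$ (i, i) * B $$ (i, i) else 0)"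
      unfolding entry[OF that that] by (rule sum.cong) (auto intro!: zero that)
    then show ?thesis using that by simp
  qed
qed

lemma upper_triangular_pow:
  assumes "A \<in> carrier_mat n n" "upper_triangular (A :: 'a :: comm_ring_1 mat)"
  shows "upper_triangular (A ^\<^sub>m k)" and "\<And>i. i < n \<Longrightarrow> (A ^\<^sub>m k) $$ (i, i) = A $$ (i, i) ^ k"
proof (induction k)
  case 0
  { case 1 then show ?case using assms by (auto) }
  { case (2 i) then show ?case using assms by auto }
next
  case (Suc k)
  have c: "A ^\<^sub>m k \<in> carrier_mat n n" using assms by (simp add: pow_carrier_mat)
  { case 1 then show ?case using upper_triangular_mult(1)[OF c assms(1) Suc(1) assms(2)] by simp }
  { case (2 i) then show ?case
      using upper_triangular_mult(2)[OF c assms(1) Suc(1) assms(2), of i] Suc(2)[of i]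
      by (simp add: mult.commute) }
qed

text \<open>This is the equality case of the triangle inequality: every real part is at most 1, and
  their sum leaves no room for a smaller one.\<close>

lemma sum_unit_eq_card_imp_one:
  fixes f :: "'a \<Rightarrow> complex"
  assumes "finite I" "\<And>i. i \<in> I \<Longrightarrow> norm (f i) = 1" "(\<Sum>i\<in>I. f i) = of_nat (card I)" "i \<in> I"
  shows "f i = 1"
proof -
  have le: "Re (f j) \<le> 1" if "j \<in> I" for j
    using complex_Re_le_cmod[of "f j"] assms(2)[OF that] by simp
  have "(\<Sum>j\<in>I. 1 - Re (f j)) = real (card I) - Re (\<Sum>j\<in>I. f j)"
    by (simp add: sum_subtractf)
  also have "\<dots> = 0" by (simp add: assms(3))
  finally have "1 - Re (f i) = 0"
    using assms(1,4) le by (subst (asm) sum_nonneg_eq_0_iff) auto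
  then have re: "Re (f i) = 1" by simp
  with assms(2)[OF assms(4)] have "Im (f i) = 0"
    by (simp add: cmod_def)
  with re show ?thesis by (simp add: complex_eq_iff)
qed

text \<open>The hypothesis says \<open>(1 + B + \<dots> + B^(m-1)) * (B - 1) = 0\<close>, and the first factor
  is triangular with all diagonal entries equal to \<open>m\<close>.\<close>
lemma unipotent_finite_order:
  fixes B :: "complex mat"
  assumes B: "B \<in> carrier_mat n n" "upper_triangular B" "\<And>i. i < n \<Longrightarrow> B $$ (i, i) = 1"
    and m: "m > 0" "B ^\<^sub>m m = 1\<^sub>m n"
  shows "B = 1\<^sub>m n"
proof -
  \<comment> \<open>The geometric sum 1 + B + ... + B^(k-1), written entrywise; \<open>T 0\<close>
    is the zero matrix.\<close>
  define T where "T k = mat n n (\<lambda>(i, j). \<Sum>l<k. (B ^\<^sub>m l) $$ (i, j))" for k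
  have pow: "B ^\<^sub>m l \<in> carrier_mat n n" for l using B by (simp add: pow_carrier_mat)
  have T: "T k \<in> carrier_mat n n" for k by (simp add: T_def)
  have T_Suc: "T (Suc k) = T k + B ^\<^sub>m k" for k
    using pow[of k] B(1) by (intro eq_matI) (auto simp: T_def split: if_splits simp del: pow_mat.simps)
  have tele: "T k * (B - 1\<^sub>m n) = B ^\<^sub>m k - 1\<^sub>m n" for k
  proof (induction k)
    case 0
    have "T 0 = 0\<^sub>m n n" by (rule eq_matI) (auto simp: T_def)
    then show ?case using B by (intro eq_matI) auto
  next
    case (Suc k)
    have "T (Suc k) * (B - 1\<^sub>m n) = T k * (B - 1\<^sub>m n) + B ^\<^sub>m k * (B - 1\<^sub>m n)"
      unfolding T_Suc by (rule add_mult_distrib_mat[OF T pow]) auto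
    also have "B ^\<^sub>m k * (B - 1\<^sub>m n) = B ^\<^sub>m Suc k - B ^\<^sub>m k"
      using mult_minus_distrib_mat[OF pow B(1) one_carrier_mat, of k] right_mult_one_mat[OF pow, of k]
      by simp
    also have "T k * (B - 1\<^sub>m n) + (B ^\<^sub>m Suc k - B ^\<^sub>m k) = B ^\<^sub>m Suc k - 1\<^sub>m n"
    proof -
      have "X - 1\<^sub>m n + (Y - X) = Y - 1\<^sub>m n"
        if "X \<in> carrier_mat n n" "Y \<in> carrier_mat n n" for X Y :: "complex mat"
        using that by (intro eq_matI) auto
      then show ?thesis unfolding Suc using pow by blast
    qed
    finally show ?case .
  qed
  have "upper_triangular (T m)"
  proof (intro upper_triangularI)
    fix i j assume "j < i" "i < dim_row (T m)"
    then show "T m $$ (i, j) = 0"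
      using upper_triangular_pow(1)[OF B(1,2)] pow B(1)
      by (auto simp: T_def intro!: sum.neutral upper_triangularD)
  qed
  moreover have "T m $$ (i, i) = of_nat m" if "i < n" for i
    using that B(3) by (simp add: T_def upper_triangular_pow(2)[OF B(1,2)])
  ultimately have "det (T m) = of_nat m ^ n"
    using T[of m] by (subst det_upper_triangular) (auto simp: prod_list_diag_prod)
  \<comment> \<open>An invertible \<open>T m\<close> can be cancelled from
    \<open>T m * (B - 1\<^sub>m n)\<close>, which is zero by telescoping.\<close>
  then have "det (T m) \<noteq> 0" using m by simp
  then obtain R where R: "R \<in> carrier_mat n n" "R * T m = 1\<^sub>m n"
    using det_non_zero_imp_unit[OF T[of m], of "()"] unfolding Units_def
    by (auto simp: ring_mat_simps)
  have "B - 1\<^sub>m n = R * T m * (B - 1\<^sub>m n)" using R B by simp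
  also have "\<dots> = R * (T m * (B - 1\<^sub>m n))"
    by (rule assoc_mult_mat) (use R B T in auto)
  also have "T m * (B - 1\<^sub>m n) = 0\<^sub>m n n" unfolding tele m(2) by simp
  finally have "B - 1\<^sub>m n = 0\<^sub>m n n" using R by simp
  then have "(B - 1\<^sub>m n) $$ (i, j) = 0" if "i < n" "j < n" for i j using that by simp
  then show ?thesis using B(1) by (intro eq_matI) auto
qed

text \<open>The n eigenvalues are roots of unity with sum n, so all are 1. The triangular form is
  then unipotent of finite order, hence the identity. This is what recovers the kernel of a
  representation from its character.\<close>

lemma trace_eq_dim_finite_order:
  assumes A: "A \<in> carrier_mat n n" and m: "m > 0" "A ^\<^sub>m m = 1\<^sub>m n"
    and tr: "mat_trace A = of_nat n"
  shows "A = 1\<^sub>m n"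
proof -
  from char_poly_factorized[OF A] obtain as where "char_poly A = (\<Prod>a\<leftarrow>as. [:- a, 1:])" by auto
  from schur_decomposition_exists[OF A this] obtain B P Q where B: "B \<in> carrier_mat n n"
    "upper_triangular B" "similar_mat_wit A B P Q" unfolding similar_mat_def by auto
  from similar_mat_witD2[OF A B(3)]
  have PQ: "P \<in> carrier_mat n n" "Q \<in> carrier_mat n n" "P * Q = 1\<^sub>m n" "Q * P = 1\<^sub>m n"
    "A = P * B * Q" by auto
  have Bm: "B ^\<^sub>m m = 1\<^sub>m n"
  proof -
    have s: "similar_mat_wit B A Q P" by (rule similar_mat_wit_sym[OF B(3)])
    have "B ^\<^sub>m m = Q * A ^\<^sub>m m * P"
      using similar_mat_wit_pow_id[OF s] .
    then show ?thesis using PQ m by simp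
  qed
  have diag: "B $$ (i, i) = 1" if "i < n" for i
  proof (rule sum_unit_eq_card_imp_one[of "{..<n}" "\<lambda>i. B $$ (i, i)"])
    fix j assume "j \<in> {..<n}"
    \<comment> \<open>Diagonal entries of triangular powers are powers of the diagonal entries, so
      each one is an m-th root of unity.\<close>
    then have "B $$ (j, j) ^ m = 1"
      using upper_triangular_pow(2)[OF B(1,2), of j m] Bm by simp
    then have "norm (B $$ (j, j)) ^ m = 1" by (metis norm_one norm_power)
    then show "norm (B $$ (j, j)) = 1"
      using m(1) power_eq_imp_eq_base[of "norm (B $$ (j, j))" m 1] by simp
  next
    have "mat_trace A = mat_trace B"
      unfolding PQ(5) by (rule mat_trace_conj) (use PQ B in auto)
    then show "(\<Sum>i<n. B $$ (i, i)) = of_nat (card {..<n})"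
      using tr B by (simp add: mat_trace_def)
  qed (use that in auto)
  have "B = 1\<^sub>m n" by (rule unipotent_finite_order[OF B(1,2) diag m(1) Bm])
  then show ?thesis using PQ by simp
qed

section \<open>Bases adapted to a subspace\<close>

context vectorspace
begin

text \<open>A maximal independent set between \<open>B\<close> and \<open>U\<close> exists because
  independent sets have at most \<open>dim\<close> elements. It is used twice: for a basis of a
  subspace, and to complete that basis to one of the whole space.\<close>

lemma lin_indpt_extend:
  assumes fin: "fin_dim" and B: "B \<subseteq> U" "lin_indpt B" and U: "U \<subseteq> carrier V"
  obtains C where "B \<subseteq> C" "C \<subseteq> U" "finite C" "lin_indpt C" "U \<subseteq> span C"
proof -
  obtain C where max: "maximal C (\<lambda>S. B \<subseteq> S \<and> S \<subseteq> U \<and> lin_indpt S)"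
    using maximal_exists[of "\<lambda>S. B \<subseteq> S \<and> S \<subseteq> U \<and> lin_indpt S" dim B] li_le_dim[OF fin] B U
    by (meson order_trans subset_refl)
  then have C: "B \<subseteq> C" "C \<subseteq> U" "lin_indpt C" by (auto simp: maximal_def)
  have "v \<in> span C" if "v \<in> U" for v
  proof (cases "v \<in> C")
    case True then show ?thesis using in_own_span[of C] C U by auto
  next
    case False
    then have "lin_dep (C \<union> {v})"
      using max that C unfolding maximal_def by blast
    then show ?thesis
      using lin_dep_iff_in_span[of C v] C U that False by auto
  qed
  then show ?thesis using that[of C] C U li_le_dim(1)[OF fin, of C] by auto
qed

end

lemma subspace_vec_iff:
  "VectorSpace.subspace class_ring W (module_vec TYPE('a :: field) n) \<longleftrightarrow>
    W \<subseteq> carrier_vec n \<and> 0\<^sub>v n \<in> W \<and> (\<forall>v\<in>W. \<forall>w\<in>W. v + w \<in> W) \<and> (\<forall>c. \<forall>v\<in>W. c \<cdot>\<^sub>v v \<in> W)"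
proof -
  interpret vec_space "TYPE('a)" n .
  have "VectorSpace.subspace class_ring W V \<longleftrightarrow> submodule class_ring W V"
    using vectorspace_axioms by (auto simp: VectorSpace.subspace_def)
  then show ?thesis
    using module_axioms by (auto simp: submodule_def class_ring_simps module_vec_simps)
qed

text \<open>In the new coordinates \<open>Q v\<close> the subspace is spanned by the first \<open>k\<close> unit vectors.\<close>
lemma subspace_adapted_basis:
  fixes W :: "complex vec set"
  assumes W: "VectorSpace.subspace class_ring W (module_vec TYPE(complex) n)"
  obtains P Q k where "P \<in> carrier_mat n n" "Q \<in> carrier_mat n n" "P * Q = 1\<^sub>m n" "Q * P = 1\<^sub>m n"
    "k \<le> n" "\<And>w. w \<in> carrier_vec n \<Longrightarrow> w \<in> W \<longleftrightarrow> (\<forall>i. k \<le> i \<longrightarrow> i < n \<longrightarrow> (Q *\<^sub>v w) $ i = 0)"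
proof -
  interpret vec_space "TYPE(complex)" n .
  have Wc: "W \<subseteq> carrier_vec n" and Wsub: "submodule class_ring W V"
    using W by (auto simp: subspace_vec_iff intro: submodule.intro subspace.submod)
  obtain B where B: "B \<subseteq> W" "finite B" "lin_indpt B" "W \<subseteq> span B"
    using lin_indpt_extend[OF fin_dim, of "{}" W] Wc by (auto simp: lin_dep_def)
  obtain C where C: "B \<subseteq> C" "C \<subseteq> carrier_vec n" "finite C" "lin_indpt C" "carrier_vec n \<subseteq> span C"
    by (rule lin_indpt_extend[OF fin_dim, of B "carrier_vec n"]) (use B Wc in auto)
  have spanB: "span B = W"
    using B span_is_subset[OF B(1) Wsub] by auto
  obtain bs where bs: "distinct bs" "set bs = B" using finite_distinct_list[OF B(2)] by auto
  obtain cs where cs: "distinct cs" "set cs = C - B" using finite_distinct_list C(3) by (metis finite_Diff)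
  \<comment> \<open>\<open>k\<close> is the dimension of \<open>W\<close>. The columns of
    \<open>P\<close> are a basis of \<open>W\<close> followed by vectors completing it to a basis of
    the whole space.\<close>
  define k where "k = length bs"
  define P where "P = mat_of_cols n (bs @ cs)"
  have "basis C" using C by (auto simp: basis_def span_is_subset2)
  then have "card C = n" using dim_basis[OF C(3)] dim_is_n by simp
  moreover have dist: "distinct (bs @ cs)" and set: "set (bs @ cs) = C" using bs cs C by auto
  ultimately have len: "length (bs @ cs) = n" by (metis distinct_card)
  have P: "P \<in> carrier_mat n n" using mat_of_cols_carrier(1)[of n "bs @ cs"] len by (simp only: P_def)
  \<comment> \<open>The columns of \<open>P\<close> span everything, so each unit vector has a
    preimage; these preimages are the columns of a right inverse.\<close>
  have "\<exists>v\<in>carrier_vec n. P *\<^sub>v v = unit_vec n j" for j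
  proof -
    have "unit_vec n j \<in> span_list (bs @ cs)"
      using C span_list_as_span[of "bs @ cs"] unfolding set by auto
    then obtain c where "unit_vec n j = lincomb_list c (bs @ cs)" unfolding span_list_def by auto
    then have "unit_vec n j = P *\<^sub>v vec n c"
      using bs cs C len by (subst (asm) lincomb_list_as_mat_mult) (auto simp: P_def)
    then show ?thesis by (metis vec_carrier)
  qed
  then obtain q where q: "q j \<in> carrier_vec n" "P *\<^sub>v q j = unit_vec n j" for j by metis
  define Q where "Q = mat_of_cols n (map q [0..<n])"
  have Q0: "Q \<in> carrier_mat n n" by (simp add: Q_def carrier_matI)
  have "P * Q = 1\<^sub>m n"
  proof (rule eq_matI)
    fix i j assume ij: "i < dim_row (1\<^sub>m n :: complex mat)" "j < dim_col (1\<^sub>m n :: complex mat)"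
    then have "(P * Q) $$ (i, j) = (P *\<^sub>v q j) $ i"
      using P q(1) by (simp add: Q_def)
    then show "(P * Q) $$ (i, j) = 1\<^sub>m n $$ (i, j)" using q ij by simp
  qed (use P Q0 in auto)
  with mat_mult_left_right_inverse[OF P Q0] Q0
  have Q: "Q \<in> carrier_mat n n" "P * Q = 1\<^sub>m n" "Q * P = 1\<^sub>m n" by auto
  have k: "k \<le> n" using len by (simp add: k_def)
  have bsc: "bs ! j \<in> carrier_vec n" if "j < k" for j
    using that bs B Wc unfolding k_def by (meson nth_mem subsetD)
  have colP: "col P j = bs ! j" if "j < k" for j
    using that len bsc[OF that] unfolding P_def k_def
    by (subst col_mat_of_cols) (auto simp: nth_append)
  have unit: "Q *\<^sub>v (bs ! j) = unit_vec n j" if "j < k" for j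
  proof -
    have "Q *\<^sub>v (bs ! j) = col (Q * P) j"
      using that k col_mult2[OF Q(1) P, of j] colP[OF that] by simp
    then show ?thesis using Q that k by simp
  qed
  have "w \<in> W \<longleftrightarrow> (\<forall>i. k \<le> i \<longrightarrow> i < n \<longrightarrow> (Q *\<^sub>v w) $ i = 0)" if w: "w \<in> carrier_vec n" for w
  proof
    assume "w \<in> W"
    then have "w \<in> span_list bs"
      using spanB span_list_as_span[of bs] bs B Wc by auto
    then obtain c where "w = lincomb_list c bs" unfolding span_list_def by auto
    then have eq: "w = mat_of_cols n bs *\<^sub>v vec k c"
      using bs B Wc by (subst (asm) lincomb_list_as_mat_mult) (auto simp: k_def)
    have mv: "(M *\<^sub>v vec k c) $ i = (\<Sum>j<k. M $$ (i, j) * c j)"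
      if "M \<in> carrier_mat n k" "i < n" for M i
      using that by (simp add: scalar_prod_def atLeast0LessThan)
    have mb: "mat_of_cols n bs \<in> carrier_mat n k" by (simp add: k_def)
    have "(Q *\<^sub>v w) $ i = 0" if i: "k \<le> i" "i < n" for i
    proof -
      have "Q *\<^sub>v w = (Q * mat_of_cols n bs) *\<^sub>v vec k c"
        unfolding eq using Q mb by (subst assoc_mult_mat_vec) auto
      also have "\<dots> $ i = (\<Sum>j<k. (Q * mat_of_cols n bs) $$ (i, j) * c j)"
        by (rule mv) (use Q mb i in auto)
      also have "\<dots> = 0"
      proof (intro sum.neutral ballI)
        fix j assume j: "j \<in> {..<k}"
        then have "(Q * mat_of_cols n bs) $$ (i, j) = (Q *\<^sub>v (bs ! j)) $ i"
          using Q mb i bsc[of j] by (simp add: k_def)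
        then show "(Q * mat_of_cols n bs) $$ (i, j) * c j = 0"
          using unit[of j] j i k by auto
      qed
      finally show ?thesis .
    qed
    then show "\<forall>i. k \<le> i \<longrightarrow> i < n \<longrightarrow> (Q *\<^sub>v w) $ i = 0" by blast
  next
    assume *: "\<forall>i. k \<le> i \<longrightarrow> i < n \<longrightarrow> (Q *\<^sub>v w) $ i = 0"
    have "w = P *\<^sub>v (Q *\<^sub>v w)"
      using assoc_mult_mat_vec[OF P Q(1) w] Q w by simp
    \<comment> \<open>The coordinates from \<open>k\<close> on vanish, so only the columns taken
      from \<open>bs\<close> contribute.\<close>
    also have "\<dots> = mat_of_cols n bs *\<^sub>v vec k (\<lambda>j. (Q *\<^sub>v w) $ j)"
    proof (rule eq_vecI)
      fix i assume "i < dim_vec (mat_of_cols n bs *\<^sub>v vec k (\<lambda>j. (Q *\<^sub>v w) $ j))"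
      then have i: "i < n" by simp
      have "(P *\<^sub>v (Q *\<^sub>v w)) $ i = (\<Sum>j<n. P $$ (i, j) * (Q *\<^sub>v w) $ j)"
        using P Q i by (simp add: scalar_prod_def atLeast0LessThan)
      also have "\<dots> = (\<Sum>j<k. P $$ (i, j) * (Q *\<^sub>v w) $ j)"
        using k * by (intro sum.mono_neutral_right) auto
      also have "\<dots> = (\<Sum>j<k. mat_of_cols n bs $$ (i, j) * (Q *\<^sub>v w) $ j)"
        using i len by (intro sum.cong) (auto simp: P_def k_def mat_of_cols_def nth_append)
      also have "\<dots> = (mat_of_cols n bs *\<^sub>v vec k (\<lambda>j. (Q *\<^sub>v w) $ j)) $ i"
        using i by (simp add: scalar_prod_def atLeast0LessThan k_def)
      finally show "(P *\<^sub>v (Q *\<^sub>v w)) $ i = (mat_of_cols n bs *\<^sub>v vec k (\<lambda>j. (Q *\<^sub>v w) $ j)) $ i" .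
    qed (use P in simp)
    also have "\<dots> = lincomb_list (\<lambda>j. (Q *\<^sub>v w) $ j) bs"
      using bs B Wc by (subst lincomb_list_as_mat_mult) (auto simp: k_def)
    also have "\<dots> \<in> span_list bs" unfolding span_list_def by auto
    finally show "w \<in> W" using spanB span_list_as_span[of bs] bs B Wc by auto
  qed
  then show ?thesis using that P Q k by blast
qed

section \<open>Characters\<close>

lemma GL_simps [simp]:
  "carrier (GL n) = Units (ring_mat TYPE(complex) n ())" "A \<otimes>\<^bsub>GL n\<^esub> B = A * B" "\<one>\<^bsub>GL n\<^esub> = 1\<^sub>m n"
  by (simp_all add: GL_def units_of_def ring_mat_simps)

lemma group_GL: "group (GL n)"
proof -
  interpret R: ring "ring_mat TYPE(complex) n ()" by (rule ring_mat)
  show ?thesis unfolding GL_def by (rule R.units_group)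
qed

text \<open>Invertibility of \<open>\<rho> g\<close> comes for free, with inverse
  \<open>\<rho> (inv g)\<close>, once \<open>\<rho>\<close> is multiplicative and sends the identity
  to \<open>1\<^sub>m n\<close>.\<close>

lemma (in group) representation_iff:
  "representation G n \<rho> \<longleftrightarrow>
    (\<forall>g\<in>carrier G. \<rho> g \<in> carrier_mat n n) \<and> \<rho> \<one> = 1\<^sub>m n \<and>
    (\<forall>g\<in>carrier G. \<forall>h\<in>carrier G. \<rho> (g \<otimes> h) = \<rho> g * \<rho> h)" (is "_ \<longleftrightarrow> ?R")
proof
  assume *: "representation G n \<rho>"
  then have "group_hom G (GL n) \<rho>"
    by (simp add: representation_def group_hom_def group_hom_axioms_def group_GL is_group)
  then have "\<rho> \<one> = 1\<^sub>m n" using group_hom.hom_one by fastforce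
  then show ?R using * by (auto simp: representation_def hom_def Units_def ring_mat_simps)
next
  assume R: ?R
  have "\<rho> g \<in> Units (ring_mat TYPE(complex) n ())" if "g \<in> carrier G" for g
  proof -
    have "\<rho> g * \<rho> (inv g) = 1\<^sub>m n" "\<rho> (inv g) * \<rho> g = 1\<^sub>m n"
      using R that by (metis inv_closed l_inv r_inv)+
    then show ?thesis using R that by (auto simp: Units_def ring_mat_simps)
  qed
  then show "representation G n \<rho>" using R by (auto simp: representation_def hom_def)
qed

lemma (in group) representation_pow:
  assumes "representation G n \<rho>" "g \<in> carrier G"
  shows "\<rho> (g [^] (k :: nat)) = \<rho> g ^\<^sub>m k"
  using assms by (induction k) (auto simp: representation_iff)

text \<open>The order of the group annihilates every \<open>g\<close>, so \<open>\<rho> g\<close>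
  has finite order and trace n forces it to be the identity matrix.\<close>

lemma (in group) char_kernel_eq_kernel:
  assumes "finite (carrier G)" "representation G n \<rho>"
  shows "char_kernel G (character_of G \<rho>) = kernel G (GL n) \<rho>"
proof -
  have key: "\<rho> g = 1\<^sub>m n" if g: "g \<in> carrier G" and "mat_trace (\<rho> g) = of_nat n" for g
  proof (rule trace_eq_dim_finite_order)
    show "\<rho> g \<in> carrier_mat n n" using assms g by (simp add: representation_iff)
    show "Coset.order G > 0" using assms(1) order_gt_0_iff_finite by blast
    show "\<rho> g ^\<^sub>m Coset.order G = 1\<^sub>m n"
      unfolding representation_pow[OF assms(2) g, symmetric] pow_order_eq_1[OF g]
      using assms(2) by (simp add: representation_iff)
  qed fact
  have "mat_trace (\<rho> g) = of_nat n \<longleftrightarrow> \<rho> g = 1\<^sub>m n" if "g \<in> carrier G" for g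
    using key[OF that] by (metis mat_trace_one)
  moreover have "\<rho> \<one> = 1\<^sub>m n" using assms(2) by (simp add: representation_iff)
  ultimately show ?thesis
    by (auto simp: char_kernel_def kernel_def character_of_def)
qed

lemma (in group) Irr_degree:
  assumes "finite (carrier G)" "\<chi> \<in> Irr G"
  obtains n where "n > 0" "\<chi> \<one> = of_nat n"
  using assms by (auto simp: Irr_def irreducible_representation_def representation_iff character_of_def)

lemma (in group) char_kernel_normal:
  assumes "finite (carrier G)" "\<chi> \<in> Irr G"
  shows "char_kernel G \<chi> \<lhd> G"
proof -
  obtain n \<rho> where \<rho>: "representation G n \<rho>" "\<chi> = character_of G \<rho>"
    using assms(2) by (auto simp: Irr_def irreducible_representation_def)
  note ker = char_kernel_eq_kernel[OF assms(1) \<rho>(1)]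
  interpret group_hom G "GL n" \<rho>
    using \<rho>(1) by (simp add: representation_def group_hom_def group_hom_axioms_def group_GL is_group)
  show ?thesis unfolding \<rho>(2) ker by (rule normal_kernel)
qed

section \<open>Sums of character values over the group\<close>

text \<open>The fixed vectors form an invariant subspace. If it is zero, the sum of all
  \<open>\<rho> g\<close>, whose image is fixed, vanishes and so does its trace. If it is
  everything, every subspace is invariant, which forces degree 1.\<close>

lemma (in group) sum_irreducible_character:
  assumes fin: "finite (carrier G)" and "\<chi> \<in> Irr G"
  shows "(\<forall>g\<in>carrier G. \<chi> g = 1) \<or> (\<Sum>g\<in>carrier G. \<chi> g) = 0"
proof -
  obtain n \<rho> where irr: "irreducible_representation G n \<rho>" and \<chi>: "\<chi> = character_of G \<rho>"
    using assms(2) by (auto simp: Irr_def)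
  then have rep: "representation G n \<rho>" and n: "n > 0"
    and inv: "\<And>W. invariant_subspace G n \<rho> W \<Longrightarrow> W = {0\<^sub>v n} \<or> W = carrier_vec n"
    by (auto simp: irreducible_representation_def)
  have c [simp]: "\<rho> g \<in> carrier_mat n n" if "g \<in> carrier G" for g
    using rep that by (simp add: representation_iff)
  have zero: "\<rho> g *\<^sub>v 0\<^sub>v n = 0\<^sub>v n" if "g \<in> carrier G" for g
    using c[OF that] by (intro eq_vecI) auto
  define W where "W = {v \<in> carrier_vec n. \<forall>g\<in>carrier G. \<rho> g *\<^sub>v v = v}"
  have "invariant_subspace G n \<rho> W"
    unfolding invariant_subspace_def subspace_vec_iff
    by (auto simp: W_def zero mult_add_distrib_mat_vec[OF c] mult_mat_vec[OF c])
  from inv[OF this] consider "W = {0\<^sub>v n}" | "W = carrier_vec n" by blast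
  then show ?thesis
  proof cases
    case 1
    define T where "T = mat n n (\<lambda>(i, j). \<Sum>g\<in>carrier G. \<rho> g $$ (i, j))"
    have T: "T \<in> carrier_mat n n" by (simp add: T_def)
    have inv_T: "\<rho> h * T = T" if h: "h \<in> carrier G" for h
    proof (rule eq_matI)
      fix i j assume "i < dim_row T" "j < dim_col T"
      then have ij: "i < n" "j < n" using T by auto
      have "(\<rho> h * T) $$ (i, j) = (\<Sum>l<n. \<rho> h $$ (i, l) * T $$ (l, j))"
        using ij T c[OF h] by (simp add: scalar_prod_def atLeast0LessThan)
      also have "\<dots> = (\<Sum>l<n. \<Sum>g\<in>carrier G. \<rho> h $$ (i, l) * \<rho> g $$ (l, j))"
        using ij by (simp add: T_def sum_distrib_left)
      also have "\<dots> = (\<Sum>g\<in>carrier G. \<Sum>l<n. \<rho> h $$ (i, l) * \<rho> g $$ (l, j))"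
        by (rule sum.swap)
      also have "\<dots> = (\<Sum>g\<in>carrier G. \<rho> (h \<otimes> g) $$ (i, j))"
      proof (rule sum.cong[OF refl])
        fix g assume g: "g \<in> carrier G"
        have "\<rho> (h \<otimes> g) = \<rho> h * \<rho> g" using rep g h by (simp add: representation_iff)
        then show "(\<Sum>l<n. \<rho> h $$ (i, l) * \<rho> g $$ (l, j)) = \<rho> (h \<otimes> g) $$ (i, j)"
          using ij c[OF h] c[OF g] by (simp add: scalar_prod_def atLeast0LessThan)
      qed
      \<comment> \<open>Left multiplication by \<open>h\<close> permutes the group.\<close>
      also have "\<dots> = (\<Sum>g\<in>carrier G. \<rho> g $$ (i, j))"
        by (rule sum.reindex_bij_witness[of _ "\<lambda>g. inv h \<otimes> g" "\<lambda>g. h \<otimes> g"])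
          (use h in \<open>auto simp: m_assoc[symmetric]\<close>)
      finally show "(\<rho> h * T) $$ (i, j) = T $$ (i, j)" using ij by (simp add: T_def)
    qed (use T c[OF h] in auto)
    have "T $$ (i, i) = 0" if i: "i < n" for i
    proof -
      have "\<rho> h *\<^sub>v (T *\<^sub>v unit_vec n i) = T *\<^sub>v unit_vec n i" if "h \<in> carrier G" for h
        using assoc_mult_mat_vec[OF c[OF that] T, of "unit_vec n i"] inv_T[OF that] by simp
      then have "T *\<^sub>v unit_vec n i \<in> W" using T by (simp add: W_def)
      then have "T *\<^sub>v unit_vec n i = 0\<^sub>v n" using 1 by simp
      then have "(T *\<^sub>v unit_vec n i) $ i = 0" using i by simp
      then show ?thesis using T i by simp
    qed
    moreover have "(\<Sum>g\<in>carrier G. \<chi> g) = (\<Sum>i<n. T $$ (i, i))"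
    proof -
      have "(\<Sum>g\<in>carrier G. \<chi> g) = (\<Sum>g\<in>carrier G. \<Sum>i<n. \<rho> g $$ (i, i))"
        by (rule sum.cong) (auto simp: \<chi> character_of_def mat_trace_def carrier_matD(1)[OF c])
      also have "\<dots> = (\<Sum>i<n. T $$ (i, i))"
        by (subst sum.swap) (simp add: T_def)
      finally show ?thesis .
    qed
    ultimately show ?thesis by simp
  next
    case 2
    have fix_vec: "\<rho> g *\<^sub>v v = v" if "g \<in> carrier G" "v \<in> carrier_vec n" for g v
      using that 2 unfolding W_def by blast
    \<comment> \<open>The line through the first unit vector; it is invariant because the action is
      trivial, so irreducibility makes it the whole space.\<close>
    define U where "U = {v \<in> carrier_vec n :: complex vec set. \<forall>i. 0 < i \<longrightarrow> i < n \<longrightarrow> v $ i = 0}"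
    have "invariant_subspace G n \<rho> U"
      unfolding invariant_subspace_def subspace_vec_iff by (auto simp: U_def fix_vec)
    moreover have "unit_vec n 0 \<in> U" using n by (simp add: U_def)
    moreover have "unit_vec n 0 \<noteq> (0\<^sub>v n :: complex vec)" using n by simp
    ultimately have U: "U = carrier_vec n" using inv[of U] by blast
    have "n = 1"
    proof (rule ccontr)
      assume "n \<noteq> 1"
      then have "1 < n" using n by simp
      moreover have "unit_vec n 1 \<in> U" unfolding U by simp
      ultimately show False by (auto simp: U_def)
    qed
    moreover have "\<rho> g = 1\<^sub>m n" if g: "g \<in> carrier G" for g
    proof (rule eq_matI)
      fix i j assume ij: "i < dim_row (1\<^sub>m n :: complex mat)" "j < dim_col (1\<^sub>m n :: complex mat)"
      then have "(\<rho> g *\<^sub>v unit_vec n j) $ i = \<rho> g $$ (i, j)" using c[OF g] by simp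
      then show "\<rho> g $$ (i, j) = 1\<^sub>m n $$ (i, j)" using ij fix_vec[OF g, of "unit_vec n j"] by simp
    qed (use c[OF g] in auto)
    ultimately show ?thesis by (simp add: \<chi> character_of_def)
  qed
qed

section \<open>Splitting characters into irreducible ones\<close>

text \<open>In a basis adapted to a proper nonzero invariant subspace all matrices become block
  upper triangular. The diagonal blocks are representations of smaller degree whose traces add up.
  The list \<open>cs\<close> records multiplicities.\<close>

lemma (in group) character_decomposition:
  assumes "representation G n \<rho>"
  shows "\<exists>cs. set cs \<subseteq> Irr G \<and> (\<forall>g\<in>carrier G. mat_trace (\<rho> g) = (\<Sum>\<chi>\<leftarrow>cs. \<chi> g))"
  using assms
proof (induction n arbitrary: \<rho> rule: less_induct)
  case (less n)
  note rep = less.prems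
  have c: "\<rho> g \<in> carrier_mat n n" if "g \<in> carrier G" for g
    using rep that by (simp add: representation_iff)
  \<comment> \<open>Degree 0 is a separate case because irreducibility demands a positive degree; it
    yields the empty list.\<close>
  consider "n = 0" | "irreducible_representation G n \<rho>"
    | W where "invariant_subspace G n \<rho> W" "W \<noteq> {0\<^sub>v n}" "W \<noteq> carrier_vec n"
    using rep by (auto simp: irreducible_representation_def)
  then show ?case
  proof cases
    case 1
    then have "dim_row (\<rho> g) = 0" if "g \<in> carrier G" for g using c[OF that] by simp
    then show ?thesis by (intro exI[of _ "[]"]) (simp add: mat_trace_def)
  next
    case 2
    then show ?thesis
      by (intro exI[of _ "[character_of G \<rho>]"]) (auto simp: Irr_def character_of_def)
  next
    case 3
    from 3(1) have W: "VectorSpace.subspace class_ring W (module_vec TYPE(complex) n)"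
      and W_inv: "\<And>g w. g \<in> carrier G \<Longrightarrow> w \<in> W \<Longrightarrow> \<rho> g *\<^sub>v w \<in> W"
      by (auto simp: invariant_subspace_def)
    obtain P Q k where PQ: "P \<in> carrier_mat n n" "Q \<in> carrier_mat n n" "P * Q = 1\<^sub>m n" "Q * P = 1\<^sub>m n"
      and "k \<le> n"
      and W_iff: "\<And>w. w \<in> carrier_vec n \<Longrightarrow>
        w \<in> W \<longleftrightarrow> (\<forall>i. k \<le> i \<longrightarrow> i < n \<longrightarrow> (Q *\<^sub>v w) $ i = 0)"
      using subspace_adapted_basis[OF W] by metis
    \<comment> \<open>Since \<open>W\<close> is neither everything nor zero, both blocks are smaller
      than n, as the induction needs.\<close>
    have "k \<noteq> n"
    proof
      assume "k = n"
      then have "carrier_vec n \<subseteq> W" using W_iff by auto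
      then show False using W 3(3) by (auto simp: subspace_vec_iff)
    qed
    have "k \<noteq> 0"
    proof
      assume k0: "k = 0"
      have "w = 0\<^sub>v n" if "w \<in> W" for w
      proof -
        have w: "w \<in> carrier_vec n" using that W by (auto simp: subspace_vec_iff)
        have "Q *\<^sub>v w = 0\<^sub>v n" using W_iff[OF w] that k0 PQ by (intro eq_vecI) auto
        then have "P *\<^sub>v (Q *\<^sub>v w) = 0\<^sub>v n" using PQ by auto
        then show ?thesis using assoc_mult_mat_vec[OF PQ(1,2) w] PQ w by simp
      qed
      then show False using 3(2) W by (auto simp: subspace_vec_iff)
    qed
    define M where "M g = Q * \<rho> g * P" for g
    have M: "M g \<in> carrier_mat n n" if "g \<in> carrier G" for g
      using c[OF that] PQ by (simp add: M_def)
    have M_one: "M \<one> = 1\<^sub>m n" using rep PQ by (simp add: M_def representation_iff)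
    have M_mult: "M (g \<otimes> h) = M g * M h" if "g \<in> carrier G" "h \<in> carrier G" for g h
    proof -
      have "M g * M h = Q * \<rho> g * (P * (Q * \<rho> h * P))"
        unfolding M_def by (rule assoc_mult_mat[of _ n n _ n _ n])
          (use c that PQ in \<open>auto intro!: mult_carrier_mat[of _ n n]\<close>)
      also have "P * (Q * \<rho> h * P) = P * (Q * (\<rho> h * P))"
        by (subst assoc_mult_mat[of Q n n _ n _ n])
          (use c that PQ in \<open>auto intro!: mult_carrier_mat[of _ n n]\<close>)
      also have "\<dots> = P * Q * (\<rho> h * P)"
        by (rule assoc_mult_mat[of _ n n _ n _ n, symmetric])
          (use c that PQ in \<open>auto intro!: mult_carrier_mat[of _ n n]\<close>)
      also have "\<dots> = \<rho> h * P"
        unfolding PQ(3) by (rule left_mult_one_mat[OF mult_carrier_mat[OF c[OF that(2)] PQ(1)]])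
      also have "Q * \<rho> g * (\<rho> h * P) = Q * \<rho> g * \<rho> h * P"
        by (rule assoc_mult_mat[of _ n n _ n _ n, symmetric])
          (use c that PQ in \<open>auto intro!: mult_carrier_mat[of _ n n]\<close>)
      also have "Q * \<rho> g * \<rho> h = Q * (\<rho> g * \<rho> h)"
        by (rule assoc_mult_mat[of _ n n _ n _ n])
          (use c that PQ in \<open>auto intro!: mult_carrier_mat[of _ n n]\<close>)
      finally show ?thesis using rep that by (simp add: M_def representation_iff)
    qed
    \<comment> \<open>The lower left block vanishes: the first \<open>k\<close> columns of
      \<open>P\<close> lie in \<open>W\<close>, and \<open>\<rho> g\<close> preserves
      \<open>W\<close>.\<close>
    have M_zero: "M g $$ (i, j) = 0" if g: "g \<in> carrier G" and ij: "k \<le> i" "i < n" "j < k" for g i j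
    proof -
      have j: "j < n" using ij by simp
      have Pj: "col P j \<in> carrier_vec n" using PQ j by (simp add: carrier_vecI)
      have "Q *\<^sub>v col P j = unit_vec n j" using col_mult2[OF PQ(2,1) j] PQ(4) j by simp
      then have "col P j \<in> W" using W_iff[OF Pj] ij by auto
      then have "\<rho> g *\<^sub>v col P j \<in> W" using W_inv g by blast
      then have "(Q *\<^sub>v (\<rho> g *\<^sub>v col P j)) $ i = 0"
        using W_iff[of "\<rho> g *\<^sub>v col P j"] c[OF g] Pj ij by auto
      also have "Q *\<^sub>v (\<rho> g *\<^sub>v col P j) = Q * \<rho> g *\<^sub>v col P j"
        by (rule assoc_mult_mat_vec[symmetric]) (use PQ c[OF g] Pj in auto)
      also have "\<dots> = col (M g) j"
        unfolding M_def by (rule col_mult2[symmetric]) (use PQ c[OF g] j in auto)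
      finally show ?thesis using M[OF g] ij j by simp
    qed
    have M_entry: "M (g \<otimes> h) $$ (i, j) = (\<Sum>l<n. M g $$ (i, l) * M h $$ (l, j))"
      if "g \<in> carrier G" "h \<in> carrier G" "i < n" "j < n" for g h i j
      using M[OF that(1)] M[OF that(2)] that
      by (simp add: M_mult scalar_prod_def atLeast0LessThan)
    \<comment> \<open>\<open>A\<close> is the action on \<open>W\<close> and \<open>D\<close> the
      action on the quotient by \<open>W\<close>, in the adapted coordinates.\<close>
    define A where "A g = mat k k (\<lambda>(i, j). M g $$ (i, j))" for g
    define D where "D g = mat (n - k) (n - k) (\<lambda>(i, j). M g $$ (i + k, j + k))" for g
    have "representation G k A"
    proof -
      have "A (g \<otimes> h) = A g * A h" if gh: "g \<in> carrier G" "h \<in> carrier G" for g h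
      proof (rule eq_matI)
        fix i j assume "i < dim_row (A g * A h)" "j < dim_col (A g * A h)"
        then have ij: "i < k" "j < k" by (auto simp: A_def)
        have "M (g \<otimes> h) $$ (i, j) = (\<Sum>l<k. M g $$ (i, l) * M h $$ (l, j))"
          using M_entry[OF gh, of i j] ij \<open>k \<le> n\<close> gh
          by (simp add: M_zero sum.mono_neutral_right[of "{..<n}" "{..<k}"])
        then show "A (g \<otimes> h) $$ (i, j) = (A g * A h) $$ (i, j)"
          using ij by (simp add: A_def scalar_prod_def atLeast0LessThan)
      qed (auto simp: A_def)
      moreover have "A \<one> = 1\<^sub>m k"
        using \<open>k \<le> n\<close> by (intro eq_matI) (auto simp: A_def M_one)
      ultimately show ?thesis by (auto simp: representation_iff A_def)
    qed
    moreover have "representation G (n - k) D"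
    proof -
      have "D (g \<otimes> h) = D g * D h" if gh: "g \<in> carrier G" "h \<in> carrier G" for g h
      proof (rule eq_matI)
        fix i j assume "i < dim_row (D g * D h)" "j < dim_col (D g * D h)"
        then have ij: "i < n - k" "j < n - k" by (auto simp: D_def)
        have "M (g \<otimes> h) $$ (i + k, j + k) = (\<Sum>l<n. M g $$ (i + k, l) * M h $$ (l, j + k))"
          using M_entry[OF gh, of "i + k" "j + k"] ij by simp
        \<comment> \<open>For l < k the factor from \<open>M g\<close> lies in the zero block; in
          the computation for \<open>A\<close> it was the factor from \<open>M h\<close> with k
          \<le> l.\<close>
        also have "\<dots> = (\<Sum>l\<in>{k..<n}. M g $$ (i + k, l) * M h $$ (l, j + k))"
          using ij gh by (intro sum.mono_neutral_right) (auto simp: M_zero)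
        also have "\<dots> = (\<Sum>l<n - k. M g $$ (i + k, l + k) * M h $$ (l + k, j + k))"
          by (rule sum.reindex_bij_witness[of _ "\<lambda>l. l + k" "\<lambda>l. l - k"]) auto
        finally show "D (g \<otimes> h) $$ (i, j) = (D g * D h) $$ (i, j)"
          using ij by (simp add: D_def scalar_prod_def atLeast0LessThan)
      qed (auto simp: D_def)
      moreover have "D \<one> = 1\<^sub>m (n - k)"
        by (intro eq_matI) (auto simp: D_def M_one)
      ultimately show ?thesis by (auto simp: representation_iff D_def)
    qed
    moreover have "mat_trace (\<rho> g) = mat_trace (A g) + mat_trace (D g)" if g: "g \<in> carrier G" for g
    proof -
      have "mat_trace (\<rho> g) = mat_trace (M g)"
        unfolding M_def by (rule mat_trace_conj[symmetric]) (use PQ c[OF g] in auto)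
      also have "\<dots> = (\<Sum>i<n. M g $$ (i, i))" using M[OF g] by (simp add: mat_trace_def)
      also have "\<dots> = (\<Sum>i<k. M g $$ (i, i)) + (\<Sum>i\<in>{k..<n}. M g $$ (i, i))"
        using \<open>k \<le> n\<close> by (simp add: sum.atLeastLessThan_concat flip: atLeast0LessThan)
      also have "(\<Sum>i\<in>{k..<n}. M g $$ (i, i)) = (\<Sum>i<n - k. M g $$ (i + k, i + k))"
        by (rule sum.reindex_bij_witness[of _ "\<lambda>l. l + k" "\<lambda>l. l - k"]) auto
      finally show ?thesis by (simp add: mat_trace_def A_def D_def)
    qed
    moreover have "k < n" "n - k < n" using \<open>k \<le> n\<close> \<open>k \<noteq> n\<close> \<open>k \<noteq> 0\<close> by auto
    ultimately obtain as ds where "set as \<subseteq> Irr G" "set ds \<subseteq> Irr G"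
      "\<forall>g\<in>carrier G. mat_trace (\<rho> g) = (\<Sum>\<chi>\<leftarrow>as. \<chi> g) + (\<Sum>\<chi>\<leftarrow>ds. \<chi> g)"
      using less.IH[of k A] less.IH[of "n - k" D] by metis
    then show ?thesis by (intro exI[of _ "as @ ds"]) auto
  qed
qed

section \<open>The regular character and divisibility of the order\<close>

text \<open>Left multiplication gives permutation matrices, whose trace counts fixed points; only
  the identity has any.\<close>

lemma (in group) regular_character:
  assumes fin: "finite (carrier G)"
  obtains \<rho> where "representation G (Coset.order G) \<rho>"
    "\<And>g. g \<in> carrier G \<Longrightarrow> mat_trace (\<rho> g) = (if g = \<one> then of_nat (Coset.order G) else 0)"
proof -
  define N where "N = Coset.order G"
  obtain f where f: "bij_betw f {..<N} (carrier G)"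
    using ex_bij_betw_nat_finite[OF fin] by (auto simp: N_def Coset.order_def atLeast0LessThan)
  have f_in: "f i \<in> carrier G" if "i < N" for i using f that by (auto simp: bij_betw_def)
  have f_inj: "f i = f j \<longleftrightarrow> i = j" if "i < N" "j < N" for i j
    using f that by (auto simp: bij_betw_def inj_on_def)
  define \<rho> where "\<rho> g = mat N N (\<lambda>(i, j). if f i = g \<otimes> f j then 1 else 0 :: complex)" for g
  have "\<rho> (g \<otimes> h) = \<rho> g * \<rho> h" if gh: "g \<in> carrier G" "h \<in> carrier G" for g h
  proof (rule eq_matI)
    fix i j assume "i < dim_row (\<rho> g * \<rho> h)" "j < dim_col (\<rho> g * \<rho> h)"
    then have ij: "i < N" "j < N" by (auto simp: \<rho>_def)
    have "h \<otimes> f j \<in> carrier G" using gh f_in ij by simp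
    \<comment> \<open>\<open>m\<close> is the index of \<open>h \<otimes> f j\<close>, the only
      place where column j of \<open>\<rho> h\<close> is nonzero.\<close>
    then obtain m where m: "m < N" "f m = h \<otimes> f j"
      using f unfolding bij_betw_def by (metis imageE lessThan_iff)
    have "(\<rho> g * \<rho> h) $$ (i, j) = (\<Sum>l<N. \<rho> g $$ (i, l) * \<rho> h $$ (l, j))"
      using ij by (simp add: \<rho>_def scalar_prod_def atLeast0LessThan)
    also have "\<dots> = (\<Sum>l<N. if l = m then \<rho> g $$ (i, m) else 0)"
      using ij m by (intro sum.cong) (auto simp: \<rho>_def f_inj simp flip: m(2))
    also have "\<dots> = \<rho> (g \<otimes> h) $$ (i, j)"
      using ij m gh f_in by (simp add: \<rho>_def m_assoc)
    finally show "\<rho> (g \<otimes> h) $$ (i, j) = (\<rho> g * \<rho> h) $$ (i, j)" by simp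
  qed (auto simp: \<rho>_def)
  moreover have "\<rho> \<one> = 1\<^sub>m N"
    by (intro eq_matI) (auto simp: \<rho>_def f_in f_inj)
  ultimately have "representation G N \<rho>" by (auto simp: representation_iff \<rho>_def)
  moreover have "mat_trace (\<rho> g) = (if g = \<one> then of_nat N else 0)" if g: "g \<in> carrier G" for g
  proof -
    have "f i = g \<otimes> f i \<longleftrightarrow> g = \<one>" if "i < N" for i
      using r_cancel_one'[of "f i" g] f_in[OF that] g by simp
    then have "mat_trace (\<rho> g) = (\<Sum>i<N. if g = \<one> then 1 else 0)"
      by (auto simp: mat_trace_def \<rho>_def)
    then show ?thesis by simp
  qed
  ultimately show ?thesis using that unfolding N_def by blast
qed

text \<open>The trivial character occurs exactly once in the regular character, because the values of
  any other irreducible character sum to \<open>0\<close>.\<close>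
lemma (in group) order_dvd_if_dvd_degree_multiples:
  assumes fin: "finite (carrier G)"
    and dvd: "\<And>\<chi> n. \<chi> \<in> Irr G \<Longrightarrow> \<not> (\<forall>g\<in>carrier G. \<chi> g = 1) \<Longrightarrow> \<chi> \<one> = of_nat n \<Longrightarrow> Coset.order G dvd n * m"
  shows "Coset.order G dvd m"
proof -
  define N where "N = Coset.order G"
  have N: "N > 0" using fin order_gt_0_iff_finite by (auto simp: N_def)
  obtain \<rho> where \<rho>: "representation G N \<rho>"
    "\<And>g. g \<in> carrier G \<Longrightarrow> mat_trace (\<rho> g) = (if g = \<one> then of_nat N else 0)"
    using regular_character[OF fin] unfolding N_def by metis
  obtain cs where cs: "set cs \<subseteq> Irr G" "\<forall>g\<in>carrier G. mat_trace (\<rho> g) = (\<Sum>\<chi>\<leftarrow>cs. \<chi> g)"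
    using character_decomposition[OF \<rho>(1)] by blast
  have "\<forall>\<chi>. \<exists>n. \<chi> \<in> Irr G \<longrightarrow> \<chi> \<one> = of_nat n" by (metis Irr_degree[OF fin])
  then obtain d where d: "\<chi> \<one> = of_nat (d \<chi>)" if "\<chi> \<in> Irr G" for \<chi> :: "'a \<Rightarrow> complex" by metis
  \<comment> \<open>Summing \<open>t\<close> over \<open>cs\<close> counts the occurrences of the
    trivial character.\<close>
  define t where "t \<chi> = (if \<forall>g\<in>carrier G. \<chi> g = 1 then 1 else 0 :: nat)" for \<chi> :: "'a \<Rightarrow> complex"
  have "(of_nat N :: complex) = (\<Sum>\<chi>\<leftarrow>cs. \<chi> \<one>)" using cs(2) \<rho>(2)[of \<one>] by simp
  also have "\<dots> = (\<Sum>\<chi>\<leftarrow>cs. of_nat (d \<chi>))"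
    using cs(1) d by (intro arg_cong[of _ _ sum_list] map_cong) auto
  also have "\<dots> = of_nat (\<Sum>\<chi>\<leftarrow>cs. d \<chi>)" by (induction cs) auto
  finally have sum_d: "N = (\<Sum>\<chi>\<leftarrow>cs. d \<chi>)" using of_nat_eq_iff by blast
  \<comment> \<open>Summing the regular character over the group gives N, while each trivial
    constituent contributes N and every other one 0.\<close>
  have "(of_nat N :: complex) = (\<Sum>g\<in>carrier G. \<Sum>\<chi>\<leftarrow>cs. \<chi> g)"
    using cs(2) \<rho>(2) fin by (simp flip: cs(2))
  also have "\<dots> = (\<Sum>\<chi>\<leftarrow>cs. \<Sum>g\<in>carrier G. \<chi> g)" by (induction cs) (auto simp: sum.distrib)
  also have "\<dots> = (\<Sum>\<chi>\<leftarrow>cs. of_nat N * of_nat (t \<chi>))"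
    using cs(1) sum_irreducible_character[OF fin]
    by (intro arg_cong[of _ _ sum_list] map_cong) (auto simp: t_def N_def Coset.order_def)
  also have "\<dots> = of_nat (N * (\<Sum>\<chi>\<leftarrow>cs. t \<chi>))" by (induction cs) (auto simp: distrib_left)
  finally have "N = N * (\<Sum>\<chi>\<leftarrow>cs. t \<chi>)" using of_nat_eq_iff by blast
  then have sum_t: "(\<Sum>\<chi>\<leftarrow>cs. t \<chi>) = 1" using N by simp
  \<comment> \<open>The difference is 0 for a trivial constituent and the degree otherwise, so these
    differences add up to N - 1. Working in the integers keeps the subtraction exact.\<close>
  have "int N dvd (int (d \<chi>) - int (t \<chi>)) * int m" if "\<chi> \<in> set cs" for \<chi>
  proof (cases "\<forall>g\<in>carrier G. \<chi> g = 1")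
    case True
    then have "(of_nat (d \<chi>) :: complex) = of_nat 1" using d[of \<chi>] cs(1) that by auto
    then have "d \<chi> = 1" by (simp only: of_nat_eq_iff)
    then show ?thesis using True by (simp add: t_def)
  next
    case False
    then have "N dvd d \<chi> * m" using dvd[of \<chi> "d \<chi>"] d[of \<chi>] cs(1) that by (auto simp: N_def)
    then have "int N dvd int (d \<chi> * m)" by (simp only: of_nat_dvd_iff)
    moreover have "t \<chi> = 0" using False by (auto simp: t_def)
    ultimately show ?thesis by simp
  qed
  then have "int N dvd (\<Sum>\<chi>\<leftarrow>cs. (int (d \<chi>) - int (t \<chi>)) * int m)"
    by (induction cs) auto
  also have "\<dots> = (int (\<Sum>\<chi>\<leftarrow>cs. d \<chi>) - int (\<Sum>\<chi>\<leftarrow>cs. t \<chi>)) * int m"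
    by (induction cs) (auto simp: algebra_simps)
  also have "\<dots> = int N * int m - int m" by (simp add: sum_t algebra_simps flip: sum_d)
  finally have "int N dvd int m" by (metis dvd_diff_right_iff dvd_triv_left)
  then show ?thesis by (simp add: N_def)
qed

section \<open>From equal codegrees to divisibility\<close>

theorem theorem3p1:
  fixes S :: "('a, 'm) monoid_scheme" and G :: "('b, 'n) monoid_scheme"
  assumes "simple_group S" and "finite (carrier S)"
    and "group G" and "finite (carrier G)"
    and "cod S \<subseteq> cod G"
  shows "Coset.order S dvd Coset.order G"
proof -
  interpret S: simple_group S by fact
  interpret G: group G by fact
  show ?thesis
  proof (rule S.order_dvd_if_dvd_degree_multiples[OF assms(2)])
    fix \<chi> n
    assume \<chi>: "\<chi> \<in> Irr S" "\<not> (\<forall>g\<in>carrier S. \<chi> g = 1)" and n: "\<chi> \<one>\<^bsub>S\<^esub> = of_nat n"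
    have n0: "n > 0" using S.Irr_degree[OF assms(2) \<chi>(1)] n by (metis of_nat_eq_iff)
    \<comment> \<open>Otherwise all values would equal the degree n > 0 and have a nonzero sum,
      which is impossible for a nontrivial irreducible character.\<close>
    have "char_kernel S \<chi> \<noteq> carrier S"
    proof
      assume "char_kernel S \<chi> = carrier S"
      then have "\<chi> g = of_nat n" if "g \<in> carrier S" for g
        using that n by (auto simp: char_kernel_def)
      then have "(\<Sum>g\<in>carrier S. \<chi> g) = of_nat (Coset.order S) * of_nat n"
        by (simp add: Coset.order_def)
      then show False
        using S.sum_irreducible_character[OF assms(2) \<chi>(1)] \<chi>(2) n0 S.order_gt_one by auto
    qed
    \<comment> \<open>Simplicity leaves only the trivial subgroup, so the index in the codegree is
      the full order of \<open>S\<close>.\<close>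
    then have "char_kernel S \<chi> = {\<one>\<^bsub>S\<^esub>}"
      using S.no_real_normal_subgroup S.char_kernel_normal[OF assms(2) \<chi>(1)] by blast
    then have cod_S: "codegree S \<chi> = of_nat (Coset.order S) / of_nat n"
      using S.lagrange[OF S.triv_subgroup] by (simp add: codegree_def n)
    from assms(5) \<chi>(1) obtain \<psi> where \<psi>: "\<psi> \<in> Irr G" "codegree S \<chi> = codegree G \<psi>"
      by (auto simp: cod_def)
    obtain k where k: "k > 0" "\<psi> \<one>\<^bsub>G\<^esub> = of_nat k" by (rule G.Irr_degree[OF assms(4) \<psi>(1)])
    define K where "K = char_kernel G \<psi>"
    have lag: "card (rcosets\<^bsub>G\<^esub> K) * card K = Coset.order G"
      unfolding K_def using G.char_kernel_normal[OF assms(4) \<psi>(1)]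
      by (intro G.lagrange normal_imp_subgroup)
    have "(of_nat (Coset.order S) / of_nat n :: complex) = of_nat (card (rcosets\<^bsub>G\<^esub> K)) / of_nat k"
      using \<psi>(2) unfolding cod_S by (simp add: codegree_def k K_def)
    then have "(of_nat (Coset.order S * k) :: complex) = of_nat (n * card (rcosets\<^bsub>G\<^esub> K))"
      using k n0 by (simp add: field_simps)
    then have "Coset.order S * k = n * card (rcosets\<^bsub>G\<^esub> K)" by (simp only: of_nat_eq_iff)
    \<comment> \<open>Multiplying by \<open>card K\<close> turns the index of \<open>K\<close> into
      the order of \<open>G\<close>, by Lagrange.\<close>
    then have "Coset.order S * (k * card K) = n * Coset.order G" by (metis lag mult.assoc)
    then show "Coset.order S dvd n * Coset.order G" by (metis dvd_triv_left)
  qed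
qed

end
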